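(* Consider Algorithm A (described in the context) run on inputs $f,k,\epsilon,M$, and consider phase $j$ (the $j$-th iteration of the outer for loop). Let $\vec{x}_{\mathrm{start}}$ and $\vec{x}_{\mathrm{end}}$ be the vector $\vec{x}$ at the beginning and at the end of the phase. Then \[ f(\vec{x}_{\mathrm{end}})-f(\vec{x}_{\mathrm{start}})\ge(1-5\epsilon)\,\epsilon\,\big((1-\epsilon)^j f(\vec{x}^* )-f(\vec{x}_{\mathrm{end}})-3\epsilon f(\vec{x}^* )\big). \]
   Context: Let $f:[0,1]^n\to\mathbb{R}_+$ be a non-negative differentiable DR-submodular function (i.e. $\nabla f(\vec{x})\ge\nabla f(\vec{y})$ coordinate-wise whenever $\vec{x}\le\vec{y}$), extended to $\mathbb{R}^n_+$ by $f(\vec{x})=f(\vec{x}\wedge\vec{1})$ where $(\vec{x}\wedge\vec{1})_i=\min\{x_i,1\}$. Let $k>0$, let $\epsilon\in(0,1)$ with $1/\epsilon$ an integer, let $\vec{x}^*$ be an optimal solution of $\max\{f(\vec{x}):\vec{x}\in[0,1]^n,\|\vec{x}\|_1\le k\}$, and let $M$ satisfy $f(\vec{x}^* )\le M\le(1+\epsilon)f(\vec{x}^* )$. Notation: $\vec{0},\vec{1}$ are the all-zeros/all-ones vectors, $\vec{1}_S$ is the indicator vector of $S\subseteq[n]$, $\circ$ is the coordinate-wise product, $\le$ between vectors is coordinate-wise. Algorithm A: set $\vec{x}\gets\vec{0}$, $\vec{z}\gets\vec{0}$. For $j=1,\dots,1/\epsilon$ (phase $j$): set $\vec{x}_{\mathrm{start}}\gets\vec{x}$,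 $\vec{z}_{\mathrm{start}}\gets\vec{z}$, $v_{\mathrm{start}}\gets\frac1k\big(((1-\epsilon)^j-2\epsilon)M-f(\vec{x})\big)$, $v\gets v_{\mathrm{start}}$. While $v>\epsilon v_{\mathrm{start}}$ and $\|\vec{z}\|_1<\epsilon jk$ (one iteration): let $\vec{g}=(\vec{1}-\vec{z})\circ\nabla f(\vec{z})$ and $S=\{i\in[n]: \vec{g}_i\ge v,\ \vec{z}_i\le 1-(1-\epsilon)^j,\ \vec{z}_i-(\vec{z}_{\mathrm{start}})_i<\epsilon(1-(\vec{z}_{\mathrm{start}})_i)\}$. If $S=\emptyset$, set $v\gets(1-\epsilon)v$. Otherwise, for $\eta\in[0,\epsilon^2]$ define $\vec{z}(\eta)=\vec{z}+\eta(\vec{1}-\vec{z})\circ\vec{1}_S$, $\vec{g}(\eta)=(\vec{1}-\vec{z}(\eta))\circ\nabla f(\vec{z}(\eta))$, $S(\eta)=\{i\in S:\vec{g}(\eta)_i\ge v\}$, $T(\eta)=\{i\in S:\vec{g}(\eta)_i>0\}$; let $\eta_1$ be the maximum $\eta\in[0,\epsilon^2]$ with $|S(\eta)|\ge(1-\epsilon)|S|$ (computed exactly), let $\eta_2$ be the maximum $\eta\in[0,\epsilon^2]$ with $\|\vec{z}(\eta)\|_1\le\epsilon jk$, and $\eta\gets\min\{\eta_1,\eta_2\}$; then update $\vec{x}\gets\vec{x}+\eta(\vec{1}-\vec{x})\circ\vec{1}_{T(\eta)}$ and $\vec{z}\gets\vec{z}+\eta(\vec{1}-\vec{z})\circ\vec{1}_S$,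 and if $f(\vec{z})>f(\vec{x})$ set $\vec{x}\gets\vec{z}$. After all phases return $\vec{x}$.
   Formalization: Assumes 5ε ≤ 1, i.e. excludes ε = 1/2, 1/3, 1/4, where the claim is false (f(x)=x, n=k=M=1, ε=1/2, j=1 gives 0 ≥ 3/4); the phases up to j are taken to terminate, so that x_end exists. *)

theory Defs
  imports "HOL-Analysis.Analysis" "HOL-Library.While_Combinator"
begin

(* On vectors, 0, 1, inf, \<le> and * are all componentwise, so {0..1} is the unit cube and * is the
   coordinate-wise product. *)

definition norm1 :: "real^'n \<Rightarrow> real" where
  "norm1 x = (\<Sum>i\<in>UNIV. \<bar>x $ i\<bar>)"

definition ind :: "'n set \<Rightarrow> real^'n" where
  "ind S = (\<chi> i. indicator S i)"

(* The derivative is taken within the cube (one-sided on its boundary), where it is unique;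
   see frechet_derivative_unique_within_closed_interval. *)
definition grad :: "(real^'n \<Rightarrow> real) \<Rightarrow> real^'n \<Rightarrow> real^'n" where
  "grad f x = (\<chi> i. frechet_derivative f (at x within {0..1}) (axis i 1))"

definition diff_dr_submodular :: "(real^'n \<Rightarrow> real) \<Rightarrow> bool" where
  "diff_dr_submodular f \<longleftrightarrow>
     f differentiable_on {0..1} \<and>
     (\<forall>x\<in>{0..1}. \<forall>y\<in>{0..1}. x \<le> y \<longrightarrow> grad f y \<le> grad f x)"

definition gvec :: "(real^'n \<Rightarrow> real) \<Rightarrow> real^'n \<Rightarrow> real^'n" where
  "gvec f z = (1 - z) * grad f z"

definition active ::
  "(real^'n \<Rightarrow> real) \<Rightarrow> real \<Rightarrow> nat \<Rightarrow> real^'n \<Rightarrow> real^'n \<Rightarrow> real \<Rightarrow> 'n set" where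
  "active f \<epsilon> j zstart z v =
     {i. gvec f z $ i \<ge> v \<and> z $ i \<le> 1 - (1 - \<epsilon>) ^ j \<and>
         z $ i - zstart $ i < \<epsilon> * (1 - zstart $ i)}"

(* increase x S \<eta> is the common update x + \<eta> (1 - x) \<circ> 1_S; in particular z(\<eta>) = increase z S \<eta>. *)
definition increase :: "real^'n \<Rightarrow> 'n set \<Rightarrow> real \<Rightarrow> real^'n" where
  "increase x S \<eta> = x + \<eta> *\<^sub>R ((1 - x) * ind S)"

definition above :: "(real^'n \<Rightarrow> real) \<Rightarrow> real^'n \<Rightarrow> real \<Rightarrow> 'n set \<Rightarrow> real \<Rightarrow> 'n set" where
  "above f z v S \<eta> = {i\<in>S. gvec f (increase z S \<eta>) $ i \<ge> v}"

definition positive :: "(real^'n \<Rightarrow> real) \<Rightarrow> real^'n \<Rightarrow> 'n set \<Rightarrow> real \<Rightarrow> 'n set" where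
  "positive f z S \<eta> = {i\<in>S. gvec f (increase z S \<eta>) $ i > 0}"

definition eta1 :: "(real^'n \<Rightarrow> real) \<Rightarrow> real \<Rightarrow> real^'n \<Rightarrow> real \<Rightarrow> 'n set \<Rightarrow> real" where
  "eta1 f \<epsilon> z v S =
     (GREATEST \<eta>. 0 \<le> \<eta> \<and> \<eta> \<le> \<epsilon>\<^sup>2 \<and>
        real (card (above f z v S \<eta>)) \<ge> (1 - \<epsilon>) * real (card S))"

definition eta2 :: "real \<Rightarrow> real \<Rightarrow> nat \<Rightarrow> real^'n \<Rightarrow> 'n set \<Rightarrow> real" where
  "eta2 k \<epsilon> j z S =
     (GREATEST \<eta>. 0 \<le> \<eta> \<and> \<eta> \<le> \<epsilon>\<^sup>2 \<and> norm1 (increase z S \<eta>) \<le> \<epsilon> * real j * k)"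

definition iteration ::
  "(real^'n \<Rightarrow> real) \<Rightarrow> real \<Rightarrow> real \<Rightarrow> nat \<Rightarrow> real^'n \<Rightarrow>
   (real^'n) \<times> (real^'n) \<times> real \<Rightarrow> (real^'n) \<times> (real^'n) \<times> real" where
  "iteration f k \<epsilon> j zstart = (\<lambda>(x, z, v).
     let S = active f \<epsilon> j zstart z v in
     if S = {} then (x, z, (1 - \<epsilon>) * v)
     else
       let \<eta> = min (eta1 f \<epsilon> z v S) (eta2 k \<epsilon> j z S);
           x' = increase x (positive f z S \<eta>) \<eta>;
           z' = increase z S \<eta>
       in (if f z' > f x' then z' else x', z', v))"

(* Phase j, as a map on the pair (x, z). The result is None iff the while loop does not
   terminate, which the algorithm does not exclude: eta1 may be 0, and then the iteration
   leaves the state unchanged. *)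
definition phase ::
  "(real^'n \<Rightarrow> real) \<Rightarrow> real \<Rightarrow> real \<Rightarrow> real \<Rightarrow> nat \<Rightarrow>
   (real^'n) \<times> (real^'n) \<Rightarrow> ((real^'n) \<times> (real^'n)) option" where
  "phase f k \<epsilon> M j = (\<lambda>(xstart, zstart).
     let vstart = (((1 - \<epsilon>) ^ j - 2 * \<epsilon>) * M - f xstart) / k in
     map_option (\<lambda>(x, z, v). (x, z))
       (while_option (\<lambda>(x, z, v). v > \<epsilon> * vstart \<and> norm1 z < \<epsilon> * real j * k)
          (iteration f k \<epsilon> j zstart) (xstart, zstart, vstart)))"

(* The pair (x, z) after the first j phases. *)
primrec run ::
  "(real^'n \<Rightarrow> real) \<Rightarrow> real \<Rightarrow> real \<Rightarrow> real \<Rightarrow> nat \<Rightarrow> ((real^'n) \<times> (real^'n)) option" where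
  "run f k \<epsilon> M 0 = Some (0, 0)"
| "run f k \<epsilon> M (Suc j) = Option.bind (run f k \<epsilon> M j) (phase f k \<epsilon> M (Suc j))"

end

theory Submission
  imports Defs
begin

text \<open>Let \<open>g\<close> be the vector \<open>gvec f z\<close> and let \<open>u\<^sub>i\<close> be the fraction of the gap \<open>1 - zstart\<^sub>i\<close> that
  coordinate \<open>i\<close> has closed during the phase. For every threshold \<open>w\<close> between 0 and the current \<open>v\<close>
  the loop maintains
  \[ f(x) - f(x_{start}) \ge (1-\epsilon)\, w\, (\|z\|_1 - \|z_{start}\|_1) + \sum_i u_i \max(0, g_i - w), \]
  because an update with step \<open>\<eta>\<close> gains at least \<open>\<eta>\<close> times the sum of the positive \<open>g\<^sub>i\<close> over \<open>S\<close>, and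
  at least \<open>(1 - \<epsilon>) |S|\<close> of these are at least \<open>v\<close>. Once \<open>v\<close> has been lowered, every coordinate has
  \<open>g\<^sub>i \<le> v / (1 - \<epsilon>)\<close> or \<open>u\<^sub>i \<ge> \<epsilon> / (1 + \<epsilon>)\<close>. So the right-hand side for \<open>w = v\<close> controls
  \<open>\<epsilon> (\<Sum>i. xstar\<^sub>i max 0 g\<^sub>i)\<close>, up to a factor \<open>(1 - \<epsilon>)\<^sup>2\<close> if the norm of \<open>z\<close> has reached its limit, and
  up to \<open>k v / (1 - \<epsilon>)\<close> in the sum if \<open>v\<close> has become small. That sum bounds
  \<open>f (sup xstar z) - f z\<close> from above, and \<open>f (sup xstar z) \<ge> (1 - max\<^sub>i z\<^sub>i) f xstar\<close> by concavity of
  \<open>f\<close> in nonnegative directions. If \<open>v\<close> was never lowered, then the norm has reached its limit and the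
  first term alone suffices.\<close>

section \<open>Monotone derivatives and the chain rule along segments\<close>

text \<open>By the mean value theorem every difference quotient is a value of \<open>\<psi>\<close>
  at an intermediate point. The quotients at \<open>s\<close> tend to \<open>\<psi> s\<close>, so on
  each side some value of \<open>\<psi>\<close> is close to \<open>\<psi> s\<close>, and
  monotonicity squeezes the values in between.\<close>

lemma continuous_on_antimono_derivative:
  fixes \<phi> \<psi> :: "real \<Rightarrow> real"
  assumes der: "\<And>t. t \<in> {a..b} \<Longrightarrow> (\<phi> has_real_derivative \<psi> t) (at t within {a..b})"
    and mono: "antimono_on {a..b} \<psi>"
  shows "continuous_on {a..b} \<psi>"
  unfolding continuous_on_iff
proof (intro ballI allI impI)
  fix s e :: real assume s: "s \<in> {a..b}" and "0 < e"
  have "((\<lambda>y. (\<phi> y - \<phi> s) / (y - s)) \<longlongrightarrow> \<psi> s) (at s within {a..b})"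
    using der[OF s] by (simp add: has_field_derivative_iff)
  then obtain d where d: "0 < d"
    and slope: "\<And>y. y \<in> {a..b} \<Longrightarrow> y \<noteq> s \<Longrightarrow> \<bar>y - s\<bar> < d \<Longrightarrow>
      \<bar>(\<phi> y - \<phi> s) / (y - s) - \<psi> s\<bar> < e"
    using \<open>0 < e\<close> unfolding Lim_within dist_real_def by force
  have mvt: "\<exists>\<xi>\<in>{l<..<r}. \<phi> r - \<phi> l = \<psi> \<xi> * (r - l)" if "a \<le> l" "l < r" "r \<le> b" for l r
  proof (rule mvt_simple[OF \<open>l < r\<close>])
    fix t assume "l \<le> t" "t \<le> r"
    then have "(\<phi> has_real_derivative \<psi> t) (at t within {l..r})"
      using that by (intro has_field_derivative_subset[OF der]) auto
    then show "(\<phi> has_derivative (*) (\<psi> t)) (at t within {l..r})"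
      by (simp add: has_field_derivative_def)
  qed
  have right: "\<exists>\<xi>>s. \<forall>t\<in>{a..b}. s \<le> t \<and> t < \<xi> \<longrightarrow> \<bar>\<psi> t - \<psi> s\<bar> < e"
  proof (cases "s < b")
    case True
    define y where "y = min b (s + d / 2)"
    have y: "s < y" "y \<le> b" "y - s < d" using True d by (auto simp: y_def)
    obtain \<xi> where \<xi>: "s < \<xi>" "\<xi> < y" "\<phi> y - \<phi> s = \<psi> \<xi> * (y - s)"
      using mvt[of s y] s y by auto
    have "\<bar>\<psi> \<xi> - \<psi> s\<bar> < e" using slope[of y] \<xi> y s by auto
    moreover have "\<psi> \<xi> \<le> \<psi> t \<and> \<psi> t \<le> \<psi> s" if "t \<in> {a..b}" "s \<le> t" "t < \<xi>" for t
      using that \<xi> y s by (auto intro!: monotone_onD[OF mono])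
    ultimately show ?thesis using \<xi>(1) by (intro exI[of _ \<xi>]) fastforce
  next
    case False
    then show ?thesis using s \<open>0 < e\<close> by (intro exI[of _ "s + 1"]) auto
  qed
  have left: "\<exists>\<xi><s. \<forall>t\<in>{a..b}. \<xi> < t \<and> t \<le> s \<longrightarrow> \<bar>\<psi> t - \<psi> s\<bar> < e"
  proof (cases "a < s")
    case True
    define y where "y = max a (s - d / 2)"
    have y: "y < s" "a \<le> y" "s - y < d" using True d by (auto simp: y_def)
    obtain \<xi> where \<xi>: "y < \<xi>" "\<xi> < s" "\<phi> s - \<phi> y = \<psi> \<xi> * (s - y)"
      using mvt[of y s] s y by auto
    have "(\<phi> y - \<phi> s) / (y - s) = \<psi> \<xi>" using \<xi> by (simp add: field_simps)
    then have "\<bar>\<psi> \<xi> - \<psi> s\<bar> < e" using slope[of y] y s by auto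
    moreover have "\<psi> t \<le> \<psi> \<xi> \<and> \<psi> s \<le> \<psi> t" if "t \<in> {a..b}" "\<xi> < t" "t \<le> s" for t
      using that \<xi> y s by (auto intro!: monotone_onD[OF mono])
    ultimately show ?thesis using \<xi>(2) by (intro exI[of _ \<xi>]) fastforce
  next
    case False
    then show ?thesis using s \<open>0 < e\<close> by (intro exI[of _ "s - 1"]) auto
  qed
  obtain r where r: "r > s" "\<And>t. t \<in> {a..b} \<Longrightarrow> s \<le> t \<Longrightarrow> t < r \<Longrightarrow> \<bar>\<psi> t - \<psi> s\<bar> < e"
    using right by blast
  obtain l where l: "l < s" "\<And>t. t \<in> {a..b} \<Longrightarrow> l < t \<Longrightarrow> t \<le> s \<Longrightarrow> \<bar>\<psi> t - \<psi> s\<bar> < e"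
    using left by blast
  have "dist (\<psi> t) (\<psi> s) < e" if "t \<in> {a..b}" "dist t s < min (r - s) (s - l)" for t
    using that r(2)[of t] l(2)[of t] by (cases "s \<le> t") (auto simp: dist_real_def)
  then show "\<exists>d>0. \<forall>t\<in>{a..b}. dist t s < d \<longrightarrow> dist (\<psi> t) (\<psi> s) < e"
    using r(1) l(1) by (intro exI[of _ "min (r - s) (s - l)"]) auto
qed

text \<open>The chain rule, with derivatives within \<open>T\<close> and within the cube so that
  boundary points are covered. As \<open>grad\<close> records only the values on
  \<open>axis i 1\<close>, linearity recovers the derivative in direction \<open>d\<close>.\<close>

lemma has_derivative_along_line:
  fixes f :: "real^'n \<Rightarrow> real"
  assumes diff: "f differentiable_on {0..1}"
    and cube: "\<And>s. s \<in> T \<Longrightarrow> x + s *\<^sub>R d \<in> {0..1}" and t: "t \<in> T"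
  shows "((\<lambda>s. f (x + s *\<^sub>R d)) has_real_derivative grad f (x + t *\<^sub>R d) \<bullet> d) (at t within T)"
proof -
  let ?p = "x + t *\<^sub>R d"
  let ?D = "frechet_derivative f (at ?p within {0..1})"
  have D: "(f has_derivative ?D) (at ?p within {0..1})"
    using diff cube[OF t] unfolding differentiable_on_def by (simp flip: frechet_derivative_works)
  then have lin: "linear ?D" by (rule has_derivative_linear)
  have "?D d = ?D (\<Sum>i\<in>UNIV. d $ i *\<^sub>R axis i 1)"
    using basis_expansion[of d] by (simp add: scalar_mult_eq_scaleR)
  also have "\<dots> = grad f ?p \<bullet> d"
    by (simp add: linear_sum[OF lin] linear_scale[OF lin] inner_vec_def grad_def mult.commute)
  finally have Dd: "?D (h *\<^sub>R d) = (grad f ?p \<bullet> d) * h" for h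
    by (simp add: linear_scale[OF lin])
  have "((\<lambda>s. x + s *\<^sub>R d) has_derivative (\<lambda>h. h *\<^sub>R d)) (at t within T)"
    by (auto intro!: derivative_eq_intros)
  moreover have "(f has_derivative ?D) (at ?p within (\<lambda>s. x + s *\<^sub>R d) ` T)"
    using cube by (intro has_derivative_subset[OF D]) auto
  ultimately have "((\<lambda>s. f (x + s *\<^sub>R d)) has_derivative (\<lambda>h. ?D (h *\<^sub>R d))) (at t within T)"
    by (rule has_derivative_in_compose)
  then show ?thesis by (simp add: has_field_derivative_def Dd)
qed

lemma inner_mono_vec:
  fixes a b d :: "real^'n"
  assumes "a \<le> b" "0 \<le> d"
  shows "a \<bullet> d \<le> b \<bullet> d"
  using assms by (auto simp: inner_vec_def less_eq_vec_def intro!: sum_mono mult_right_mono)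

lemma segment_in_cube:
  fixes x y :: "real^'n"
  assumes "x \<in> {0..1}" "y \<in> {0..1}" "s \<in> {0..1::real}"
  shows "x + s *\<^sub>R (y - x) \<in> {0..1}"
proof -
  have "(1 - s) *\<^sub>R x + s *\<^sub>R y \<in> {0..1}"
    using assms convexD_alt[OF convex_box(1)[of "0::real^'n" 1]] by (simp add: interval_cbox_cart)
  then show ?thesis by (simp add: algebra_simps)
qed

lemma segment_between:
  fixes x y :: "real^'n"
  assumes "x \<le> y" "s \<in> {0..1::real}"
  shows "x \<le> x + s *\<^sub>R (y - x)" "x + s *\<^sub>R (y - x) \<le> y"
proof -
  have "s * (y $ i - x $ i) \<le> 1 * (y $ i - x $ i)" "0 \<le> s * (y $ i - x $ i)" for i
    using assms by (auto simp: less_eq_vec_def intro!: mult_left_le_one_le)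
  then show "x \<le> x + s *\<^sub>R (y - x)" "x + s *\<^sub>R (y - x) \<le> y"
    by (auto simp: less_eq_vec_def algebra_simps)
qed

section \<open>Concavity of DR-submodular functions in nonnegative directions\<close>

context
  fixes f :: "real^'n \<Rightarrow> real"
  assumes dr: "diff_dr_submodular f"
begin

lemma grad_antimono:
  assumes "0 \<le> x" "x \<le> y" "y \<le> 1"
  shows "grad f y \<le> grad f x"
  using dr assms by (auto simp: diff_dr_submodular_def)

text \<open>The increment is a slope at an intermediate point of the segment. The gradient there
  lies between those at the endpoints, and pairing with \<open>y - x \<ge> 0\<close> preserves the
  order.\<close>

lemma dr_increment_bounds:
  assumes "0 \<le> x" "x \<le> y" "y \<le> 1"
  shows "grad f y \<bullet> (y - x) \<le> f y - f x" "f y - f x \<le> grad f x \<bullet> (y - x)"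
proof -
  have xy: "x \<in> {0..1}" "y \<in> {0..1}" using assms by auto
  have d: "0 \<le> y - x" using assms by simp
  have "((\<lambda>s. f (x + s *\<^sub>R (y - x))) has_derivative
      (*) (grad f (x + t *\<^sub>R (y - x)) \<bullet> (y - x))) (at t within {0..1})" if "t \<in> {0..1}" for t
    using has_derivative_along_line[OF _ segment_in_cube[OF xy] that] dr
    by (simp add: diff_dr_submodular_def has_field_derivative_def)
  then obtain t where t: "t \<in> {0<..<1::real}"
    and eq: "f y - f x = grad f (x + t *\<^sub>R (y - x)) \<bullet> (y - x)"
    using mvt_simple[of 0 1 "\<lambda>s. f (x + s *\<^sub>R (y - x))"
      "\<lambda>s. (*) (grad f (x + s *\<^sub>R (y - x)) \<bullet> (y - x))"] by auto
  let ?p = "x + t *\<^sub>R (y - x)"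
  have "x \<le> ?p" "?p \<le> y" using t segment_between[OF assms(2), of t] by auto
  then show "grad f y \<bullet> (y - x) \<le> f y - f x" "f y - f x \<le> grad f x \<bullet> (y - x)"
    unfolding eq using assms d by (auto intro!: inner_mono_vec grad_antimono intro: order_trans)
qed

lemma dr_concave_up:
  assumes xy: "0 \<le> x" "x \<le> y" "y \<le> 1" and s: "0 \<le> s" "s \<le> 1"
  shows "(1 - s) * f x + s * f y \<le> f (x + s *\<^sub>R (y - x))"
proof -
  let ?w = "x + s *\<^sub>R (y - x)"
  have d: "0 \<le> y - x" using xy by simp
  have w: "x \<le> ?w" "?w \<le> y" using s segment_between[OF xy(2), of s] by auto
  have yw: "y - ?w = (1 - s) *\<^sub>R (y - x)" by (simp add: algebra_simps)
  have "s * (grad f ?w \<bullet> (y - x)) \<le> f ?w - f x"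
    using dr_increment_bounds(1)[of x ?w] w xy by auto
  moreover have "f y - f ?w \<le> (1 - s) * (grad f ?w \<bullet> (y - x))"
    using dr_increment_bounds(2)[of ?w y] w xy unfolding yw by auto
  \<comment> \<open>The weights \<open>s\<close> and \<open>1 - s\<close> make the two gradient
    terms equal, so they cancel.\<close>
  ultimately have "s * (f y - f ?w) \<le> s * ((1 - s) * (grad f ?w \<bullet> (y - x)))"
    "(1 - s) * (s * (grad f ?w \<bullet> (y - x))) \<le> (1 - s) * (f ?w - f x)"
    using s by (intro mult_left_mono; simp)+
  then show ?thesis by (simp add: algebra_simps)
qed

text \<open>\<open>sup x z\<close> lies at the fraction \<open>\<theta>\<close> of the segment from
  \<open>x\<close> to a point \<open>y\<close> that is still in the cube. Concavity applies on this
  segment, and \<open>\<theta> * f y\<close> is dropped as nonnegative.\<close>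

lemma sup_lower_bound:
  assumes nonneg: "\<And>x. x \<in> {0..1} \<Longrightarrow> 0 \<le> f x"
    and x: "x \<in> {0..1}" and z: "0 \<le> z" "\<And>i. z $ i \<le> \<theta>" and \<theta>: "0 < \<theta>" "\<theta> \<le> 1"
  shows "(1 - \<theta>) * f x \<le> f (sup x z)"
proof -
  define y where "y = x + (1 / \<theta>) *\<^sub>R (sup x z - x)"
  have "y $ i \<le> 1" for i
  proof -
    have x01: "0 \<le> x $ i" "x $ i \<le> 1" using x by (auto simp: less_eq_vec_def)
    have "(1 - \<theta>) * x $ i \<ge> 0" "0 \<le> \<theta> * (1 - x $ i)" using x01 \<theta> by auto
    \<comment> \<open>If \<open>z $ i\<close> exceeds \<open>x $ i\<close>, the difference is at
      most \<open>\<theta> - x $ i\<close>, hence at most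
      \<open>\<theta> * (1 - x $ i)\<close>.\<close>
    then have "sup (x $ i) (z $ i) - x $ i \<le> \<theta> * (1 - x $ i)"
      using z(2)[of i] x01 by (auto simp: sup_real_def max_def algebra_simps)
    then have "(sup (x $ i) (z $ i) - x $ i) / \<theta> \<le> 1 - x $ i"
      using \<theta> by (simp add: pos_divide_le_eq mult.commute)
    then show ?thesis by (simp add: y_def sup_vec_def)
  qed
  moreover have "x \<le> y" using \<theta> by (auto simp: y_def intro!: scaleR_nonneg_nonneg)
  ultimately have y: "x \<le> y" "y \<le> 1" by (auto simp: less_eq_vec_def)
  have "x + \<theta> *\<^sub>R (y - x) = sup x z" using \<theta> by (simp add: y_def)
  then have "(1 - \<theta>) * f x + \<theta> * f y \<le> f (sup x z)"
    using dr_concave_up[of x y \<theta>] x y \<theta> by auto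
  moreover have "0 \<le> \<theta> * f y" using nonneg[of y] x y \<theta> by (auto intro: order_trans)
  ultimately show ?thesis by simp
qed

text \<open>A nonnegative derivative decreases together with the factor \<open>1 - z\<close>. Where
  the derivative is negative, the shrinking factor may raise the product, but not above 0; so what
  is carried over is a positive upper bound.\<close>

lemma gvec_antimono_pos:
  assumes "0 \<le> z" "z \<le> z'" "z' \<le> 1" "0 < w" "gvec f z $ i \<le> w"
  shows "gvec f z' $ i \<le> w"
proof (cases "0 \<le> grad f z' $ i")
  case True
  have "grad f z' $ i \<le> grad f z $ i"
    using grad_antimono[of z z'] assms by (auto simp: less_eq_vec_def)
  then have "gvec f z' $ i \<le> gvec f z $ i"
    using assms True order_trans[of z z' 1]
    by (auto simp: gvec_def less_eq_vec_def intro!: mult_mono)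
  then show ?thesis using assms by simp
next
  case False
  have "gvec f z' $ i \<le> 0"
    using False assms by (auto simp: gvec_def less_eq_vec_def intro!: mult_nonneg_nonpos)
  then show ?thesis using assms by simp
qed

lemma sup_upper_bound:
  assumes x: "x \<in> {0..1}" and z: "z \<in> {0..1}"
  shows "f (sup x z) - f z \<le> (\<Sum>i\<in>UNIV. x $ i * max 0 (gvec f z $ i))"
proof -
  have "f (sup x z) - f z \<le> grad f z \<bullet> (sup x z - z)"
    using x z by (intro dr_increment_bounds) auto
  also have "\<dots> \<le> (\<Sum>i\<in>UNIV. x $ i * max 0 (gvec f z $ i))"
    unfolding inner_vec_def
  proof (rule sum_mono)
    fix i
    have b: "0 \<le> x $ i" "x $ i \<le> 1" "0 \<le> z $ i" "z $ i \<le> 1"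
      using x z by (auto simp: less_eq_vec_def)
    let ?d = "(sup x z - z) $ i"
    have d: "0 \<le> ?d" by (simp add: sup_vec_def)
    have "x $ i * z $ i \<le> z $ i" "0 \<le> (1 - z $ i) * x $ i" using b by (auto simp: mult_left_le_one_le)
    \<comment> \<open>\<open>?d\<close> is 0 or \<open>x $ i - z $ i\<close>, and
      \<open>x $ i * z $ i \<le> z $ i\<close>.\<close>
    then have d': "?d \<le> (1 - z $ i) * x $ i"
      by (auto simp: sup_vec_def sup_real_def max_def algebra_simps)
    have "grad f z $ i * ?d \<le> max 0 (grad f z $ i) * ?d" using d by (intro mult_right_mono) auto
    also have "\<dots> \<le> max 0 (grad f z $ i) * ((1 - z $ i) * x $ i)" using d' by (intro mult_left_mono) auto
    also have "\<dots> = x $ i * max 0 (gvec f z $ i)"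
      using b by (auto simp: gvec_def max_def zero_le_mult_iff mult_le_0_iff)
    finally show "grad f z $ i \<bullet> ?d \<le> x $ i * max 0 (gvec f z $ i)" by simp
  qed
  finally show ?thesis .
qed

end

section \<open>Coordinate updates and the 1-norm\<close>

lemma increase_nth:
  "increase x S \<eta> $ i = x $ i + (if i \<in> S then \<eta> * (1 - x $ i) else 0)"
  by (simp add: increase_def ind_def)

lemma increase_ge:
  assumes "x \<le> 1" "0 \<le> \<eta>"
  shows "x \<le> increase x S \<eta>"
  using assms by (auto simp: less_eq_vec_def increase_nth)

lemma increase_mono:
  assumes "x \<le> 1" "\<eta> \<le> \<eta>'"
  shows "increase x S \<eta> \<le> increase x S \<eta>'"
  using assms by (auto simp: less_eq_vec_def increase_nth intro!: mult_right_mono)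

lemma increase_le_one:
  assumes "x \<le> 1" "\<eta> \<le> 1"
  shows "increase x S \<eta> \<le> 1"
proof -
  have "\<eta> * (1 - x $ i) \<le> 1 * (1 - x $ i)" for i
    using assms by (intro mult_right_mono) (auto simp: less_eq_vec_def)
  then have "x $ i + \<eta> * (1 - x $ i) \<le> 1" for i by (simp add: le_diff_eq add.commute)
  then show ?thesis
    using assms by (auto simp: less_eq_vec_def increase_nth)
qed

text \<open>The map \<open>t + \<eta> * (1 - t)\<close> is monotone in \<open>t\<close> for
  \<open>\<eta> \<le> 1\<close>. This keeps \<open>x\<close> below \<open>z\<close> when
  \<open>x\<close> moves on \<open>positive\<close> and \<open>z\<close> on all of
  \<open>S\<close>.\<close>

lemma increase_le_increase:
  assumes xz: "x \<le> z" "z \<le> 1" and \<eta>: "0 \<le> \<eta>" "\<eta> \<le> 1" and "T \<subseteq> S"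
  shows "increase x T \<eta> \<le> increase z S \<eta>"
proof -
  have "x $ i + \<eta> * (1 - x $ i) \<le> z $ i + \<eta> * (1 - z $ i)" for i
  proof -
    have "0 \<le> (1 - \<eta>) * (z $ i - x $ i)" using xz \<eta> by (auto simp: less_eq_vec_def)
    then show ?thesis by (simp add: algebra_simps)
  qed
  moreover have "x $ i \<le> z $ i + \<eta> * (1 - z $ i)" for i
    using xz \<eta> by (auto simp: less_eq_vec_def intro: add_increasing2)
  ultimately show ?thesis
    using assms by (auto simp: less_eq_vec_def increase_nth)
qed

lemma norm1_nonneg_eq:
  assumes "0 \<le> x"
  shows "norm1 x = (\<Sum>i\<in>UNIV. x $ i)"
  using assms by (auto simp: norm1_def less_eq_vec_def)

lemma norm1_mono:
  assumes "0 \<le> x" "x \<le> y"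
  shows "norm1 x \<le> norm1 y"
  unfolding norm1_def using assms
  by (intro sum_mono) (metis abs_of_nonneg less_eq_vec_def order_trans zero_index)

lemma norm1_increase:
  assumes "0 \<le> x" "x \<le> 1" "0 \<le> \<eta>"
  shows "norm1 (increase x S \<eta>) = norm1 x + \<eta> * (\<Sum>i\<in>S. 1 - x $ i)"
proof -
  have "norm1 (increase x S \<eta>) = (\<Sum>i\<in>UNIV. increase x S \<eta> $ i)"
    using assms increase_ge[of x \<eta> S] by (intro norm1_nonneg_eq) auto
  also have "\<dots> = norm1 x + (\<Sum>i\<in>UNIV. if i \<in> S then \<eta> * (1 - x $ i) else 0)"
    using assms by (simp add: increase_nth norm1_nonneg_eq sum.distrib)
  also have "(\<Sum>i\<in>UNIV. if i \<in> S then \<eta> * (1 - x $ i) else 0) = \<eta> * (\<Sum>i\<in>S. 1 - x $ i)"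
    by (simp add: sum.If_cases sum_distrib_left)
  finally show ?thesis .
qed

section \<open>Attainment of the step sizes\<close>

text \<open>The step sizes are defined by \<open>GREATEST\<close>, about which nothing follows until
  a maximum is known to exist; compactness provides it.\<close>

lemma GreatestI_compact:
  fixes P :: "real \<Rightarrow> bool"
  assumes "compact {x. P x}" "P a"
  shows "P (Greatest P)"
proof -
  obtain m where "P m" "\<And>x. P x \<Longrightarrow> x \<le> m"
    using compact_attains_sup[OF assms(1)] assms(2) by auto
  then show ?thesis by (metis Greatest_equality)
qed

lemma eta2_bounds:
  assumes z: "0 \<le> z" "z \<le> 1" and norm: "norm1 z \<le> \<epsilon> * real j * k"
  shows "0 \<le> eta2 k \<epsilon> j z S" "eta2 k \<epsilon> j z S \<le> \<epsilon>\<^sup>2"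
    "norm1 (increase z S (eta2 k \<epsilon> j z S)) \<le> \<epsilon> * real j * k"
proof -
  let ?P = "\<lambda>\<eta>. 0 \<le> \<eta> \<and> \<eta> \<le> \<epsilon>\<^sup>2 \<and> norm1 (increase z S \<eta>) \<le> \<epsilon> * real j * k"
  have "{\<eta>. ?P \<eta>} = {0..\<epsilon>\<^sup>2} \<inter> {\<eta>. norm1 (increase z S \<eta>) \<le> \<epsilon> * real j * k}" by auto
  moreover have "closed {\<eta>. norm1 (increase z S \<eta>) \<le> \<epsilon> * real j * k}"
    unfolding norm1_def increase_def by (intro closed_Collect_le continuous_intros)
  ultimately have "compact {\<eta>. ?P \<eta>}" by auto
  moreover have "?P 0" using norm by (simp add: increase_def)
  ultimately have "?P (eta2 k \<epsilon> j z S)" unfolding eta2_def by (rule GreatestI_compact)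
  then show "0 \<le> eta2 k \<epsilon> j z S" "eta2 k \<epsilon> j z S \<le> \<epsilon>\<^sup>2"
    "norm1 (increase z S (eta2 k \<epsilon> j z S)) \<le> \<epsilon> * real j * k" by auto
qed

context
  fixes f :: "real^'n \<Rightarrow> real"
  assumes dr: "diff_dr_submodular f"
begin

text \<open>The gradient itself is not assumed continuous. Along the direction $d = (1 - z) \circ 1_S$
  all terms of $\nabla f \cdot d$ are decreasing and their sum is a derivative, hence continuous;
  so every single term is continuous.\<close>

lemma continuous_on_gvec_increase:
  assumes z: "0 \<le> z" "z \<le> 1" and i: "i \<in> S"
  shows "continuous_on {0..1} (\<lambda>\<eta>. gvec f (increase z S \<eta>) $ i)"
proof -
  define d where "d = (1 - z) * ind S"
  define p where "p = (\<lambda>\<eta>. increase z S \<eta>)"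
  define a where "a = (\<lambda>\<eta> l. grad f (p \<eta>) $ l * d $ l)"
  have d: "0 \<le> d $ l" for l
    using z by (auto simp: d_def ind_def less_eq_vec_def indicator_def)
  have p: "p \<eta> = z + \<eta> *\<^sub>R d" for \<eta> by (simp add: p_def increase_def d_def)
  have cube: "0 \<le> p \<eta>" "p \<eta> \<le> 1" if "\<eta> \<in> {0..1}" for \<eta>
    using that z increase_ge[of z \<eta> S] increase_le_one[of z \<eta> S] by (auto simp: p_def intro: order_trans)
  have anti: "a t l \<le> a s l" if "s \<in> {0..1}" "t \<in> {0..1}" "s \<le> t" for s t l
  proof -
    have "grad f (p t) \<le> grad f (p s)"
      using that z cube by (auto intro!: grad_antimono[OF dr] increase_mono simp: p_def)
    then show ?thesis using d by (auto simp: a_def less_eq_vec_def intro!: mult_right_mono)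
  qed
  have sum: "(\<lambda>\<eta>. grad f (p \<eta>) \<bullet> d) = (\<lambda>\<eta>. \<Sum>l\<in>UNIV. a \<eta> l)"
    by (simp add: inner_vec_def a_def)
  have "((\<lambda>s. f (p s)) has_real_derivative grad f (p \<eta>) \<bullet> d) (at \<eta> within {0..1})"
    if "\<eta> \<in> {0..1}" for \<eta>
    unfolding p using dr cube that
    by (intro has_derivative_along_line) (auto simp: diff_dr_submodular_def p)
  moreover have "antimono_on {0..1} (\<lambda>\<eta>. grad f (p \<eta>) \<bullet> d)"
    unfolding sum by (auto intro!: monotone_onI sum_mono anti)
  ultimately have cont: "continuous_on {0..1} (\<lambda>\<eta>. \<Sum>l\<in>UNIV. a \<eta> l)"
    unfolding sum[symmetric] by (rule continuous_on_antimono_derivative)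
  have le: "a s i - a t i \<le> (\<Sum>l\<in>UNIV. a s l) - (\<Sum>l\<in>UNIV. a t l)"
    if "s \<in> {0..1}" "t \<in> {0..1}" "s \<le> t" for s t
    unfolding sum_subtractf[symmetric]
    using anti[OF that] by (intro member_le_sum) auto
  have "dist (a t i) (a s i) \<le> dist (\<Sum>l\<in>UNIV. a t l) (\<Sum>l\<in>UNIV. a s l)"
    if "s \<in> {0..1}" "t \<in> {0..1}" for s t
    using le[of s t] le[of t s] anti[of s t i] anti[of t s i] that
    by (cases "s \<le> t") (auto simp: dist_real_def)
  then have "continuous_on {0..1} (\<lambda>\<eta>. a \<eta> i)"
    using cont unfolding continuous_on_iff by (meson le_less_trans)
  then have "continuous_on {0..1} (\<lambda>\<eta>. (1 - \<eta>) * a \<eta> i)"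
    by (intro continuous_intros)
  \<comment> \<open>For \<open>i \<in> S\<close> the factor
    \<open>1 - increase z S \<eta> $ i\<close> is \<open>(1 - \<eta>) * (1 - z $ i)\<close>, and
    \<open>d $ i\<close> is \<open>1 - z $ i\<close>.\<close>
  moreover have "gvec f (increase z S \<eta>) $ i = (1 - \<eta>) * a \<eta> i" for \<eta>
    using i by (simp add: gvec_def a_def p_def d_def increase_nth ind_def algebra_simps)
  ultimately show ?thesis by simp
qed

text \<open>The step taken may be shorter than \<open>eta1\<close>; this carries the cardinality
  condition over from \<open>eta1\<close> to it.\<close>

lemma above_antimono:
  assumes z: "0 \<le> z" "z \<le> 1" and "0 < v" and \<eta>: "0 \<le> \<eta>" "\<eta> \<le> \<eta>'" "\<eta>' \<le> 1"
  shows "above f z v S \<eta>' \<subseteq> above f z v S \<eta>"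
proof
  fix i assume i: "i \<in> above f z v S \<eta>'"
  have "v \<le> gvec f (increase z S \<eta>) $ i"
  proof (rule ccontr)
    \<comment> \<open>The maximum with \<open>v / 2\<close> makes \<open>w\<close> positive, as
      \<open>gvec_antimono_pos\<close> requires, yet still less than \<open>v\<close>.\<close>
    define w where "w = max (v / 2) (gvec f (increase z S \<eta>) $ i)"
    assume "\<not> ?thesis"
    then have w: "0 < w" "w < v" "gvec f (increase z S \<eta>) $ i \<le> w"
      using \<open>0 < v\<close> by (auto simp: w_def)
    have "gvec f (increase z S \<eta>') $ i \<le> w"
      using z \<eta> w increase_ge[of z \<eta> S]
      by (intro gvec_antimono_pos[OF dr _ increase_mono[of z \<eta> \<eta>' S] increase_le_one]) auto
    then show False using i w by (simp add: above_def)
  qed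
  then show "i \<in> above f z v S \<eta>" using i by (simp add: above_def)
qed

text \<open>The admissible steps form a finite union, over the large enough
  \<open>U \<subseteq> S\<close>, of the sets where all coordinates of \<open>U\<close> stay at
  least \<open>v\<close>. These are closed by continuity, and the step 0 is admissible.\<close>

lemma eta1_bounds:
  assumes z: "0 \<le> z" "z \<le> 1" and \<epsilon>: "0 < \<epsilon>" "\<epsilon> < 1" and S: "\<And>i. i \<in> S \<Longrightarrow> v \<le> gvec f z $ i"
  shows "0 \<le> eta1 f \<epsilon> z v S" "eta1 f \<epsilon> z v S \<le> \<epsilon>\<^sup>2"
    "(1 - \<epsilon>) * real (card S) \<le> real (card (above f z v S (eta1 f \<epsilon> z v S)))"
proof -
  let ?P = "\<lambda>\<eta>. 0 \<le> \<eta> \<and> \<eta> \<le> \<epsilon>\<^sup>2 \<and>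
        real (card (above f z v S \<eta>)) \<ge> (1 - \<epsilon>) * real (card S)"
  let ?F = "{U. U \<subseteq> S \<and> real (card U) \<ge> (1 - \<epsilon>) * real (card S)}"
  have \<epsilon>2: "\<epsilon>\<^sup>2 \<le> 1" using \<epsilon> by (simp add: power_le_one)
  have closed: "closed {\<eta> \<in> {0..\<epsilon>\<^sup>2}. \<forall>i\<in>U. v \<le> gvec f (increase z S \<eta>) $ i}" if "U \<subseteq> S" for U
  proof -
    have "closed {\<eta> \<in> {0..\<epsilon>\<^sup>2}. v \<le> gvec f (increase z S \<eta>) $ i}" if "i \<in> U" for i
      using \<epsilon>2 z \<open>U \<subseteq> S\<close> that
      by (intro continuous_on_closed_Collect_le continuous_intros
            continuous_on_subset[OF continuous_on_gvec_increase]) auto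
    moreover have "{\<eta> \<in> {0..\<epsilon>\<^sup>2}. \<forall>i\<in>U. v \<le> gvec f (increase z S \<eta>) $ i} =
      {0..\<epsilon>\<^sup>2} \<inter> (\<Inter>i\<in>U. {\<eta> \<in> {0..\<epsilon>\<^sup>2}. v \<le> gvec f (increase z S \<eta>) $ i})" by auto
    ultimately show ?thesis by auto
  qed
  have "{\<eta>. ?P \<eta>} = (\<Union>U\<in>?F. {\<eta> \<in> {0..\<epsilon>\<^sup>2}. \<forall>i\<in>U. v \<le> gvec f (increase z S \<eta>) $ i})" (is "_ = ?R")
  proof (intro equalityI subsetI)
    fix \<eta> assume "\<eta> \<in> {\<eta>. ?P \<eta>}"
    then show "\<eta> \<in> ?R" by (intro UN_I[of "above f z v S \<eta>"]) (auto simp: above_def)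
  next
    fix \<eta> assume "\<eta> \<in> ?R"
    then obtain U where U: "U \<in> ?F" "\<eta> \<in> {0..\<epsilon>\<^sup>2}" "U \<subseteq> above f z v S \<eta>"
      by (auto simp: above_def)
    then have "card U \<le> card (above f z v S \<eta>)" by (intro card_mono) auto
    then show "\<eta> \<in> {\<eta>. ?P \<eta>}" using U by auto
  qed
  moreover have "closed ?R" using closed by (intro closed_UN) auto
  ultimately have "closed {\<eta>. ?P \<eta>}" by simp
  moreover have "bounded {\<eta>. ?P \<eta>}" by (rule bounded_subset[of "{0..\<epsilon>\<^sup>2}"]) auto
  ultimately have "compact {\<eta>. ?P \<eta>}" by (simp add: compact_eq_bounded_closed)
  moreover have "above f z v S 0 = S" using S by (auto simp: above_def increase_def)
  then have "?P 0" using \<epsilon> by (simp add: mult_left_le_one_le)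
  ultimately have "?P (eta1 f \<epsilon> z v S)" unfolding eta1_def by (rule GreatestI_compact)
  then show "0 \<le> eta1 f \<epsilon> z v S" "eta1 f \<epsilon> z v S \<le> \<epsilon>\<^sup>2"
    "(1 - \<epsilon>) * real (card S) \<le> real (card (above f z v S (eta1 f \<epsilon> z v S)))" by auto
qed

section \<open>Gain of a single update\<close>

text \<open>The gain is at least the gradient at \<open>x'\<close> applied to the move, and this
  gradient dominates the one at \<open>z'\<close> because \<open>x' \<le> z'\<close>. Each large
  \<open>gvec\<close> entry is split into \<open>w\<close>, which pays for the growth of the norm,
  and its excess over \<open>w\<close>.\<close>

lemma step_gain:
  assumes x: "0 \<le> x" "x \<le> z" and z: "z \<le> 1" and \<eta>: "0 \<le> \<eta>" "\<eta> \<le> 1"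
    and w: "0 \<le> w" "w \<le> v" and v: "0 < v" and \<epsilon>: "\<epsilon> < 1"
    and card: "(1 - \<epsilon>) * real (card S) \<le> real (card (above f z v S \<eta>))"
  defines "z' \<equiv> increase z S \<eta>" and "x' \<equiv> increase x (positive f z S \<eta>) \<eta>"
  shows "(1 - \<epsilon>) * w * (norm1 z' - norm1 z) + \<eta> * (\<Sum>i\<in>S. max 0 (gvec f z' $ i - w)) \<le> f x' - f x"
proof -
  let ?T = "positive f z S \<eta>" and ?A = "above f z v S \<eta>"
  have T: "?T \<subseteq> S" by (auto simp: positive_def)
  have z0: "0 \<le> z" using x by simp
  have z': "z \<le> z'" "z' \<le> 1" using z \<eta> by (auto simp: z'_def increase_ge increase_le_one)
  have x': "x \<le> x'" "x' \<le> z'"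
    using x z \<eta> T unfolding z'_def x'_def by (auto intro!: increase_ge increase_le_increase)
  have grad: "grad f z' $ i \<le> grad f x' $ i" for i
    using grad_antimono[OF dr order_trans[OF x(1) x'(1)] x'(2) z'(2)] by (simp add: less_eq_vec_def)
  have summand: "\<eta> * gvec f z' $ i \<le> grad f x' $ i * (x' - x) $ i" if i: "i \<in> ?T" for i
  proof -
    have z'i: "0 \<le> 1 - z' $ i" "1 - z' $ i \<le> 1 - x $ i"
      using z' x by (auto simp: less_eq_vec_def intro: order_trans)
    have "0 < (1 - z' $ i) * grad f z' $ i" using i by (simp add: positive_def gvec_def z'_def)
    then have pos: "0 < grad f z' $ i" using z'i by (simp add: zero_less_mult_iff)
    have "gvec f z' $ i = (1 - z' $ i) * grad f z' $ i" by (simp add: gvec_def)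
    also have "\<dots> \<le> (1 - x $ i) * grad f x' $ i"
      using z'i pos grad[of i] by (intro mult_mono) auto
    finally have "\<eta> * gvec f z' $ i \<le> \<eta> * ((1 - x $ i) * grad f x' $ i)"
      using \<eta>(1) by (rule mult_left_mono)
    also have "\<dots> = grad f x' $ i * (x' - x) $ i" using i by (simp add: x'_def increase_nth)
    finally show ?thesis .
  qed
  have "\<eta> * (\<Sum>i\<in>?T. gvec f z' $ i) \<le> (\<Sum>i\<in>?T. grad f x' $ i * (x' - x) $ i)"
    unfolding sum_distrib_left by (intro sum_mono summand)
  also have "\<dots> = grad f x' \<bullet> (x' - x)"
    unfolding inner_vec_def by (simp, rule sum.mono_neutral_left) (auto simp: x'_def increase_nth)
  also have "\<dots> \<le> f x' - f x" using x x' z' by (intro dr_increment_bounds[OF dr]) auto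
  finally have gain: "\<eta> * (\<Sum>i\<in>?T. gvec f z' $ i) \<le> f x' - f x" .

  \<comment> \<open>The norm grows by at most \<open>\<eta>\<close> per coordinate of
    \<open>S\<close>, and \<open>(1 - \<epsilon>) * card S\<close> is at most
    \<open>card ?A\<close>.\<close>
  have "(\<Sum>i\<in>S. 1 - z $ i) \<le> (\<Sum>i\<in>S. 1)"
    using z0 by (intro sum_mono) (auto simp: less_eq_vec_def)
  then have "norm1 z' - norm1 z \<le> \<eta> * real (card S)"
    using z0 z \<eta> by (simp add: z'_def norm1_increase mult_left_mono)
  then have "(1 - \<epsilon>) * w * (norm1 z' - norm1 z) \<le> (1 - \<epsilon>) * w * (\<eta> * real (card S))"
    using w \<epsilon> by (intro mult_left_mono) auto
  also have "\<dots> = \<eta> * w * ((1 - \<epsilon>) * real (card S))" by (simp add: mult_ac)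
  also have "\<dots> \<le> \<eta> * w * real (card ?A)" using card w \<eta> by (intro mult_left_mono) auto
  also have "\<dots> = \<eta> * (\<Sum>i\<in>S. if i \<in> ?A then w else 0)"
  proof -
    have "S \<inter> ?A = ?A" by (auto simp: above_def)
    then show ?thesis by (simp add: sum.If_cases)
  qed
  finally have "(1 - \<epsilon>) * w * (norm1 z' - norm1 z) + \<eta> * (\<Sum>i\<in>S. max 0 (gvec f z' $ i - w))
    \<le> \<eta> * (\<Sum>i\<in>S. (if i \<in> ?A then w else 0) + max 0 (gvec f z' $ i - w))"
    by (simp add: sum.distrib distrib_left)
  \<comment> \<open>On \<open>?A\<close> the two terms add up to the entry itself. Elsewhere in
    \<open>?T\<close> the excess is at most the entry, and outside \<open>?T\<close> both terms
    vanish.\<close>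
  also have "\<dots> \<le> \<eta> * (\<Sum>i\<in>S. if i \<in> ?T then gvec f z' $ i else 0)"
    using w v \<eta> by (intro mult_left_mono sum_mono) (auto simp: above_def positive_def z'_def)
  also have "\<dots> = \<eta> * (\<Sum>i\<in>?T. gvec f z' $ i)"
    using T by (simp add: sum.If_cases Int_absorb1)
  also note gain
  finally show ?thesis .
qed

end

section \<open>Loop invariant of a phase\<close>

definition growth :: "real^'n \<Rightarrow> real^'n \<Rightarrow> 'n \<Rightarrow> real" where
  "growth zs z i = (z $ i - zs $ i) / (1 - zs $ i)"

text \<open>A coordinate moves only while its gap is at least \<open>(1 - \<epsilon>) ^ j\<close>,
  and one step multiplies the gap by at least \<open>1 - \<epsilon>\<^sup>2\<close>; the product
  bounds the overshoot.\<close>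

definition state_bounds :: "(real^'n \<Rightarrow> real) \<Rightarrow> real \<Rightarrow> real \<Rightarrow> nat \<Rightarrow> (real^'n) \<times> (real^'n) \<Rightarrow> bool" where
  "state_bounds f k \<epsilon> j = (\<lambda>(x, z). 0 \<le> x \<and> x \<le> z \<and> f z \<le> f x \<and> norm1 z \<le> \<epsilon> * real j * k \<and>
     (\<forall>i. (1 - \<epsilon>\<^sup>2) * (1 - \<epsilon>) ^ j \<le> 1 - z $ i))"

text \<open>The gain is bounded for every threshold below the current one: the bound for a fixed
  threshold is preserved by every update of \<open>z\<close>, whereas the bound for the current threshold alone
  would be lost whenever \<open>v\<close> is lowered.\<close>

definition gain_bound :: "(real^'n \<Rightarrow> real) \<Rightarrow> real \<Rightarrow> real^'n \<Rightarrow> real^'n \<Rightarrow> real^'n \<Rightarrow> real^'n \<Rightarrow> real \<Rightarrow> bool" where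
  "gain_bound f \<epsilon> xs zs x z w \<longleftrightarrow>
     (1 - \<epsilon>) * w * (norm1 z - norm1 zs) + (\<Sum>i\<in>UNIV. growth zs z i * max 0 (gvec f z $ i - w)) \<le> f x - f xs"

text \<open>The last line is a disjunction because nothing is known about the coordinates until
  \<open>v\<close> is lowered for the first time.\<close>

definition phase_inv :: "(real^'n \<Rightarrow> real) \<Rightarrow> real \<Rightarrow> real \<Rightarrow> nat \<Rightarrow> real^'n \<Rightarrow> real^'n \<Rightarrow> real \<Rightarrow>
    (real^'n) \<times> (real^'n) \<times> real \<Rightarrow> bool" where
  "phase_inv f k \<epsilon> j xs zs vs = (\<lambda>(x, z, v).
     state_bounds f k \<epsilon> j (x, z) \<and> zs \<le> z \<and> f xs \<le> f x \<and>
     (\<forall>w. 0 \<le> w \<and> w \<le> v \<longrightarrow> gain_bound f \<epsilon> xs zs x z w) \<and>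
     (v = vs \<or> 0 < v \<and> (\<forall>i. gvec f z $ i \<le> v / (1 - \<epsilon>) \<or> \<epsilon> / (1 + \<epsilon>) \<le> growth zs z i)))"

lemma state_bounds_le_one:
  assumes "state_bounds f k \<epsilon> j (x, z)" "0 < \<epsilon>" "\<epsilon> < 1"
  shows "z \<le> 1" "z $ i < 1"
proof -
  have "0 < (1 - \<epsilon>\<^sup>2) * (1 - \<epsilon>) ^ j" using assms(2,3) by (simp add: power_less_one_iff)
  then have "z $ i < 1" for i
    using assms(1) by (auto simp: state_bounds_def dest: spec[of _ i] intro: less_le_trans)
  then show "z \<le> 1" "z $ i < 1" by (auto simp: less_eq_vec_def less_imp_le)
qed

context
  fixes f :: "real^'n \<Rightarrow> real" and k \<epsilon> :: real
  assumes dr: "diff_dr_submodular f" and k: "0 < k" and eps: "0 < \<epsilon>" "\<epsilon> < 1"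
begin

lemma phase_inv_iteration:
  assumes start: "state_bounds f k \<epsilon> j (xs, zs)"
    and inv: "phase_inv f k \<epsilon> (Suc j) xs zs vs (x, z, v)" and guard: "\<epsilon> * vs < v"
  shows "phase_inv f k \<epsilon> (Suc j) xs zs vs (iteration f k \<epsilon> (Suc j) zs (x, z, v))"
proof -
  have bounds: "0 \<le> x" "x \<le> z" "f z \<le> f x" "norm1 z \<le> \<epsilon> * real (Suc j) * k"
    "\<And>i. (1 - \<epsilon>\<^sup>2) * (1 - \<epsilon>) ^ Suc j \<le> 1 - z $ i"
    and zs: "zs \<le> z" and mono: "f xs \<le> f x"
    and gain: "\<And>w. 0 \<le> w \<Longrightarrow> w \<le> v \<Longrightarrow> gain_bound f \<epsilon> xs zs x z w"
    and v: "v = vs \<or> 0 < v \<and> (\<forall>i. gvec f z $ i \<le> v / (1 - \<epsilon>) \<or> \<epsilon> / (1 + \<epsilon>) \<le> growth zs z i)"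
    using inv by (auto simp: phase_inv_def state_bounds_def)
  have z1: "z \<le> 1"
    using inv by (auto simp: phase_inv_def intro: state_bounds_le_one[OF _ eps])
  have z0: "0 \<le> z" using bounds by simp
  \<comment> \<open>\<open>vs\<close> may be negative in general; the guard
    \<open>\<epsilon> * vs < vs\<close> itself rules this out.\<close>
  have vpos: "0 < v"
  proof (cases "v = vs")
    case True
    then have "0 < (1 - \<epsilon>) * v" using guard by (simp add: algebra_simps)
    then show ?thesis using eps by (simp add: zero_less_mult_iff)
  qed (use v in auto)
  have zs1: "zs $ i < 1" for i by (rule state_bounds_le_one(2)[OF start eps])
  define S where "S = active f \<epsilon> (Suc j) zs z v"
  show ?thesis
  proof (cases "S = {}")
    case True
    have "gvec f z $ i \<le> v \<or> \<epsilon> / (1 + \<epsilon>) \<le> growth zs z i" for i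
    proof -
      \<comment> \<open>A coordinate outside \<open>S\<close> violates one of the three conditions
        of \<open>active\<close>. In terms of the lowered threshold, the bound \<open>v\<close>
        becomes the new value divided by \<open>1 - \<epsilon>\<close>.\<close>
      consider "gvec f z $ i < v" | "1 - (1 - \<epsilon>) ^ Suc j < z $ i"
        | "\<epsilon> * (1 - zs $ i) \<le> z $ i - zs $ i"
        using True by (force simp: S_def active_def not_less not_le)
      then show ?thesis
      proof cases
        case 2
        \<comment> \<open>Source of \<open>\<epsilon> / (1 + \<epsilon>)\<close>: the gap was at
          least \<open>(1 - \<epsilon>\<^sup>2) * (1 - \<epsilon>) ^ j\<close> at the start and is
          now below \<open>(1 - \<epsilon>) ^ Suc j\<close>, so it has shrunk by a factor of at
          least \<open>1 + \<epsilon>\<close>.\<close>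
        have "(1 - \<epsilon>) * ((1 + \<epsilon>) * (1 - \<epsilon>) ^ j) \<le> 1 - zs $ i"
          using start by (auto simp: state_bounds_def algebra_simps power2_eq_square)
        moreover have "(1 + \<epsilon>) * (1 - z $ i) \<le> (1 + \<epsilon>) * (1 - \<epsilon>) ^ Suc j"
          using 2 eps by (intro mult_left_mono) auto
        ultimately have "(1 + \<epsilon>) * (1 - z $ i) \<le> 1 - zs $ i" by (simp add: mult_ac)
        then have "\<epsilon> * (1 - zs $ i) \<le> (1 + \<epsilon>) * (z $ i - zs $ i)" by (simp add: algebra_simps)
        then show ?thesis using zs1[of i] eps by (simp add: growth_def divide_simps mult.commute)
      next
        case 3
        then have "\<epsilon> \<le> growth zs z i" using zs1[of i] by (simp add: growth_def le_divide_eq)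
        moreover have "\<epsilon> / (1 + \<epsilon>) \<le> \<epsilon>" using eps by (simp add: divide_le_eq)
        ultimately show ?thesis by simp
      qed auto
    qed
    moreover have "(1 - \<epsilon>) * v \<le> v" using eps vpos by (simp add: mult_left_le_one_le)
    then have "gain_bound f \<epsilon> xs zs x z w" if "0 \<le> w" "w \<le> (1 - \<epsilon>) * v" for w
      using that by (intro gain) auto
    ultimately have "phase_inv f k \<epsilon> (Suc j) xs zs vs (x, z, (1 - \<epsilon>) * v)"
      using inv eps vpos by (auto simp: phase_inv_def)
    then show ?thesis using True by (simp add: iteration_def S_def Let_def)
  next
    case False
    define \<eta> where "\<eta> = min (eta1 f \<epsilon> z v S) (eta2 k \<epsilon> (Suc j) z S)"
    define x' where "x' = increase x (positive f z S \<eta>) \<eta>"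
    define z' where "z' = increase z S \<eta>"
    define y where "y = (if f z' > f x' then z' else x')"
    have S: "v \<le> gvec f z $ i" "z $ i \<le> 1 - (1 - \<epsilon>) ^ Suc j" if "i \<in> S" for i
      using that by (auto simp: S_def active_def)
    note e1 = eta1_bounds[where S = S and v = v, OF dr z0 z1 eps S(1)]
    note e2 = eta2_bounds[OF z0 z1 bounds(4), of S]
    have \<epsilon>2: "\<epsilon>\<^sup>2 \<le> 1" using eps by (simp add: power_le_one)
    have \<eta>: "0 \<le> \<eta>" "\<eta> \<le> \<epsilon>\<^sup>2" "\<eta> \<le> 1" using e1 e2 \<epsilon>2 by (auto simp: \<eta>_def)
    have "above f z v S (eta1 f \<epsilon> z v S) \<subseteq> above f z v S \<eta>"
      using \<eta> e1 \<epsilon>2 by (intro above_antimono[OF dr z0 z1 vpos]) (auto simp: \<eta>_def)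
    then have "card (above f z v S (eta1 f \<epsilon> z v S)) \<le> card (above f z v S \<eta>)"
      by (intro card_mono) auto
    then have card: "(1 - \<epsilon>) * real (card S) \<le> real (card (above f z v S \<eta>))"
      using e1(3) by linarith
    have "norm1 z' \<le> norm1 (increase z S (eta2 k \<epsilon> (Suc j) z S))"
      unfolding z'_def using z0 z1 \<eta> increase_ge[OF z1 \<eta>(1)]
      by (intro norm1_mono increase_mono) (auto simp: \<eta>_def intro: order_trans)
    then have norm: "norm1 z' \<le> \<epsilon> * real (Suc j) * k" using e2 by simp
    have z': "z \<le> z'" "z' \<le> 1" using z1 \<eta> by (auto simp: z'_def increase_ge increase_le_one)
    have x': "x \<le> x'" "x' \<le> z'" using bounds z1 \<eta> unfolding x'_def z'_def
      by (auto intro!: increase_ge increase_le_increase simp: positive_def)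
    have y: "0 \<le> y" "y \<le> z'" "f z' \<le> f y" "f x' \<le> f y"
      using x' z' bounds z0 by (auto simp: y_def)
    have gap: "(1 - \<epsilon>\<^sup>2) * (1 - \<epsilon>) ^ Suc j \<le> 1 - z' $ i" for i
    proof (cases "i \<in> S")
      case True
      have "(1 - \<epsilon>\<^sup>2) * (1 - \<epsilon>) ^ Suc j \<le> (1 - \<eta>) * (1 - z $ i)"
        using S(2)[OF True] \<eta> eps by (intro mult_mono) auto
      then show ?thesis using True by (simp add: z'_def increase_nth algebra_simps)
    qed (use bounds in \<open>auto simp: z'_def increase_nth\<close>)
    have step: "(1 - \<epsilon>) * w * (norm1 z' - norm1 z) + \<eta> * (\<Sum>i\<in>S. max 0 (gvec f z' $ i - w))
        \<le> f x' - f x" if "0 \<le> w" "w \<le> v" for w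
      unfolding z'_def x'_def using bounds z1 \<eta> that vpos eps card by (intro step_gain[OF dr])
    have mono': "f x \<le> f y"
    proof -
      have "0 \<le> \<eta> * (\<Sum>i\<in>S. max 0 (gvec f z' $ i - 0))"
        using \<eta> by (intro mult_nonneg_nonneg sum_nonneg) auto
      \<comment> \<open>At \<open>w = 0\<close> the norm term vanishes.\<close>
      then show ?thesis using step[of 0] vpos y by simp
    qed
    have gvec': "gvec f z' $ i \<le> w" if "gvec f z $ i \<le> w" "0 < w" for i w
      using gvec_antimono_pos[OF dr z0 z'] that by simp
    have gain': "gain_bound f \<epsilon> xs zs y z' w" if w: "0 \<le> w" "w \<le> v" for w
    proof -
      \<comment> \<open>The excess over \<open>w\<close> does not increase, and
        \<open>growth\<close> rises by at most \<open>\<eta>\<close>, only on \<open>S\<close>;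
        \<open>step\<close> pays for exactly this rise.\<close>
      have summand: "growth zs z' i * max 0 (gvec f z' $ i - w) \<le>
        growth zs z i * max 0 (gvec f z $ i - w) + (if i \<in> S then \<eta> * max 0 (gvec f z' $ i - w) else 0)" for i
      proof -
        have le: "max 0 (gvec f z' $ i - w) \<le> max 0 (gvec f z $ i - w)"
        proof (cases "0 < gvec f z $ i")
          case True
          then show ?thesis using gvec'[of i "gvec f z $ i"] by auto
        next
          case False
          then have "gvec f z' $ i \<le> e" if "0 < e" for e using gvec'[of i e] that by simp
          then have "gvec f z' $ i \<le> 0" using dense_ge by blast
          then show ?thesis using w by simp
        qed
        have g0: "0 \<le> growth zs z i"
          using zs zs1[of i] by (auto simp: growth_def less_eq_vec_def)
        have "growth zs z' i \<le> growth zs z i + (if i \<in> S then \<eta> else 0)"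
        proof -
          have "\<eta> * (1 - z $ i) \<le> \<eta> * (1 - zs $ i)"
            using zs \<eta> by (intro mult_left_mono) (auto simp: less_eq_vec_def)
          then have "\<eta> * (1 - z $ i) / (1 - zs $ i) \<le> \<eta>" using zs1[of i] by (simp add: divide_le_eq)
          then show ?thesis
            by (simp add: growth_def z'_def increase_nth add_divide_distrib diff_divide_distrib)
        qed
        then have "growth zs z' i * max 0 (gvec f z' $ i - w) \<le>
          (growth zs z i + (if i \<in> S then \<eta> else 0)) * max 0 (gvec f z' $ i - w)"
          by (intro mult_right_mono) auto
        also have "\<dots> = growth zs z i * max 0 (gvec f z' $ i - w) +
          (if i \<in> S then \<eta> * max 0 (gvec f z' $ i - w) else 0)" by (simp add: algebra_simps)
        also have "growth zs z i * max 0 (gvec f z' $ i - w) \<le> growth zs z i * max 0 (gvec f z $ i - w)"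
          using le g0 by (rule mult_left_mono)
        finally show ?thesis by simp
      qed
      have "(\<Sum>i\<in>UNIV. growth zs z' i * max 0 (gvec f z' $ i - w)) \<le>
        (\<Sum>i\<in>UNIV. growth zs z i * max 0 (gvec f z $ i - w) +
          (if i \<in> S then \<eta> * max 0 (gvec f z' $ i - w) else 0))"
        by (intro sum_mono summand)
      also have "\<dots> = (\<Sum>i\<in>UNIV. growth zs z i * max 0 (gvec f z $ i - w)) +
          \<eta> * (\<Sum>i\<in>S. max 0 (gvec f z' $ i - w))"
        by (simp add: sum.distrib sum.If_cases sum_distrib_left)
      finally have "(\<Sum>i\<in>UNIV. growth zs z' i * max 0 (gvec f z' $ i - w)) \<le> \<dots>" .
      moreover have "(1 - \<epsilon>) * w * (norm1 z' - norm1 zs) =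
        (1 - \<epsilon>) * w * (norm1 z' - norm1 z) + (1 - \<epsilon>) * w * (norm1 z - norm1 zs)"
        by (simp add: algebra_simps)
      ultimately show ?thesis
        using gain[OF w] step[OF w] y(4) by (simp add: gain_bound_def)
    qed
    \<comment> \<open>Once established, either alternative persists: \<open>growth\<close> never
      falls, and positive upper bounds on \<open>gvec\<close> survive the update.\<close>
    have drop': "gvec f z' $ i \<le> v / (1 - \<epsilon>) \<or> \<epsilon> / (1 + \<epsilon>) \<le> growth zs z' i" if "v \<noteq> vs" for i
    proof -
      have "growth zs z i \<le> growth zs z' i"
        using z' zs1[of i] by (auto simp: growth_def less_eq_vec_def intro!: divide_right_mono)
      then show ?thesis using v that vpos eps gvec'[of i "v / (1 - \<epsilon>)"] by force
    qed
    have inv': "phase_inv f k \<epsilon> (Suc j) xs zs vs (y, z', v)"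
      using y norm gap zs z' mono mono' gain' drop' vpos
      by (auto simp: phase_inv_def state_bounds_def intro: order_trans)
    have "iteration f k \<epsilon> (Suc j) zs (x, z, v) =
      (if f (increase z S \<eta>) > f (increase x (positive f z S \<eta>) \<eta>) then increase z S \<eta>
       else increase x (positive f z S \<eta>) \<eta>, increase z S \<eta>, v)"
      unfolding iteration_def prod.case Let_def S_def[symmetric] \<eta>_def[symmetric]
      using False by (simp only: if_False)
    then show ?thesis using inv' unfolding y_def z'_def x'_def by (simp only:)
  qed
qed

text \<open>Both sides of every \<open>gain_bound\<close> are 0 here, and passing from
  \<open>j\<close> to \<open>Suc j\<close> relaxes the gap bound and the norm limit.\<close>

lemma phase_inv_start:
  assumes "state_bounds f k \<epsilon> j (xs, zs)"
  shows "phase_inv f k \<epsilon> (Suc j) xs zs vs (xs, zs, vs)"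
proof -
  have "(1 - \<epsilon>) * ((1 - \<epsilon>\<^sup>2) * (1 - \<epsilon>) ^ j) \<le> (1 - \<epsilon>\<^sup>2) * (1 - \<epsilon>) ^ j"
    using eps by (intro mult_left_le_one_le mult_nonneg_nonneg) (auto simp: power_le_one)
  then have "(1 - \<epsilon>\<^sup>2) * (1 - \<epsilon>) ^ Suc j \<le> 1 - zs $ i" for i
    using assms by (auto simp: state_bounds_def mult_ac intro: order_trans)
  moreover have "\<epsilon> * real j * k \<le> \<epsilon> * real (Suc j) * k"
    using eps k by (intro mult_right_mono mult_left_mono) auto
  ultimately show ?thesis
    using assms by (auto simp: phase_inv_def state_bounds_def gain_bound_def growth_def)
qed

text \<open>A result \<open>Some\<close> means that the loop terminated, so the invariant holds
  together with the negated guard.\<close>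

lemma phase_inv_phase:
  assumes start: "state_bounds f k \<epsilon> j (xs, zs)"
    and phase: "phase f k \<epsilon> M (Suc j) (xs, zs) = Some (xe, ze)"
  defines "vs \<equiv> (((1 - \<epsilon>) ^ Suc j - 2 * \<epsilon>) * M - f xs) / k"
  obtains v where "phase_inv f k \<epsilon> (Suc j) xs zs vs (xe, ze, v)"
    "v \<le> \<epsilon> * vs \<or> \<epsilon> * real (Suc j) * k \<le> norm1 ze"
proof -
  have "map_option (\<lambda>(x, z, v). (x, z))
      (while_option (\<lambda>(x, z, v). v > \<epsilon> * vs \<and> norm1 z < \<epsilon> * real (Suc j) * k)
        (iteration f k \<epsilon> (Suc j) zs) (xs, zs, vs)) = Some (xe, ze)"
    using phase unfolding phase_def Let_def prod.case vs_def .
  then obtain s where s: "while_option (\<lambda>(x, z, v). v > \<epsilon> * vs \<and> norm1 z < \<epsilon> * real (Suc j) * k)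
        (iteration f k \<epsilon> (Suc j) zs) (xs, zs, vs) = Some s" "(case s of (x, z, v) \<Rightarrow> (x, z)) = (xe, ze)"
    unfolding map_option_eq_Some by blast
  obtain v where "s = (xe, ze, v)" using s(2) by (cases s rule: prod_cases3) simp
  note loop = s(1)[unfolded this]
  have "phase_inv f k \<epsilon> (Suc j) xs zs vs (xe, ze, v)"
  proof (rule while_option_rule[OF _ loop])
    fix s assume inv: "phase_inv f k \<epsilon> (Suc j) xs zs vs s"
      and guard: "case s of (x, z, v) \<Rightarrow> v > \<epsilon> * vs \<and> norm1 z < \<epsilon> * real (Suc j) * k"
    obtain x z v where s: "s = (x, z, v)" by (rule prod_cases3)
    have "\<epsilon> * vs < v" using guard unfolding s prod.case by (rule conjunct1)
    then show "phase_inv f k \<epsilon> (Suc j) xs zs vs (iteration f k \<epsilon> (Suc j) zs s)"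
      unfolding s by (rule phase_inv_iteration[OF start inv[unfolded s]])
  qed (rule phase_inv_start[OF start])
  moreover have "\<not> (\<epsilon> * vs < v \<and> norm1 ze < \<epsilon> * real (Suc j) * k)"
    using while_option_stop[OF loop] unfolding prod.case .
  then have "v \<le> \<epsilon> * vs \<or> \<epsilon> * real (Suc j) * k \<le> norm1 ze"
    unfolding de_Morgan_conj not_less .
  ultimately show ?thesis by (rule that)
qed

lemma state_bounds_run:
  assumes "run f k \<epsilon> M j = Some s"
  shows "state_bounds f k \<epsilon> j s"
  using assms
proof (induction j arbitrary: s)
  case 0
  then show ?case using eps by (auto simp: state_bounds_def norm1_def)
next
  case (Suc j)
  then obtain xs zs where run: "run f k \<epsilon> M j = Some (xs, zs)"
    and phase: "phase f k \<epsilon> M (Suc j) (xs, zs) = Some s"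
    by (auto simp: bind_eq_Some_conv)
  obtain xe ze where s: "s = (xe, ze)" by (cases s)
  show ?case
    using phase_inv_phase[OF Suc.IH[OF run] phase[unfolded s]] unfolding s phase_inv_def by blast
qed

end

section \<open>The bound for one phase\<close>

theorem theorem3:
  fixes f :: "real^'n \<Rightarrow> real" and k \<epsilon> M :: real and j :: nat
    and xstar xstart zstart xend zend :: "real^'n"
  assumes f_nonneg: "\<And>x. x \<in> {0..1} \<Longrightarrow> 0 \<le> f x"
    and f_dr: "diff_dr_submodular f"
    and f_ext: "\<And>x. 0 \<le> x \<Longrightarrow> f x = f (inf x 1)"
    and k_pos: "0 < k"
    and eps: "0 < \<epsilon>" "\<epsilon> < 1" "1 / \<epsilon> \<in> \<int>"
    and eps_small: "5 * \<epsilon> \<le> 1"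
    and opt: "is_arg_max f (\<lambda>x. x \<in> {0..1} \<and> norm1 x \<le> k) xstar"
    and M: "f xstar \<le> M" "M \<le> (1 + \<epsilon>) * f xstar"
    and j: "1 \<le> j" "real j \<le> 1 / \<epsilon>"
    and phase_start: "run f k \<epsilon> M (j - 1) = Some (xstart, zstart)"
    and phase_end: "phase f k \<epsilon> M j (xstart, zstart) = Some (xend, zend)"
  shows "f xend - f xstart \<ge>
           (1 - 5 * \<epsilon>) * \<epsilon> * ((1 - \<epsilon>) ^ j * f xstar - f xend - 3 * \<epsilon> * f xstar)"
proof -
  obtain i where i: "j = Suc i" using j(1) by (cases j) auto
  have start: "state_bounds f k \<epsilon> i (xstart, zstart)"
    using state_bounds_run[OF f_dr k_pos eps(1,2)] phase_start i by simp
  define p where "p = (1 - \<epsilon>) ^ Suc i"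
  define vs where "vs = ((p - 2 * \<epsilon>) * M - f xstart) / k"
  obtain v where inv: "phase_inv f k \<epsilon> (Suc i) xstart zstart vs (xend, zend, v)"
    and exit: "v \<le> \<epsilon> * vs \<or> \<epsilon> * real (Suc i) * k \<le> norm1 zend"
    using phase_inv_phase[OF f_dr k_pos eps(1,2) start phase_end[unfolded i]]
    unfolding vs_def p_def by blast
  have bounds: "0 \<le> xend" "xend \<le> zend" "f zend \<le> f xend"
    "\<And>l. (1 - \<epsilon>\<^sup>2) * p \<le> 1 - zend $ l"
    and zs: "zstart \<le> zend" and mono: "f xstart \<le> f xend"
    and gain: "\<And>w. 0 \<le> w \<Longrightarrow> w \<le> v \<Longrightarrow> gain_bound f \<epsilon> xstart zstart xend zend w"
    and v: "v = vs \<or>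
      0 < v \<and> (\<forall>l. gvec f zend $ l \<le> v / (1 - \<epsilon>) \<or> \<epsilon> / (1 + \<epsilon>) \<le> growth zstart zend l)"
    using inv by (auto simp: phase_inv_def state_bounds_def p_def)
  have zend: "0 \<le> zend" "zend \<le> 1"
    using inv bounds by (auto simp: phase_inv_def intro: state_bounds_le_one[OF _ eps(1,2)])
  have zs0: "0 \<le> zstart" and zs_norm: "norm1 zstart \<le> \<epsilon> * real i * k"
    using start by (auto simp: state_bounds_def)
  have zs1: "zstart $ l < 1" for l by (rule state_bounds_le_one(2)[OF start eps(1,2)])
  have "xstart \<le> zstart" using start by (simp add: state_bounds_def)
  also have "zstart \<le> 1" by (rule state_bounds_le_one(1)[OF start eps(1,2)])
  finally have xstart: "xstart \<in> {0..1}" using start by (simp add: state_bounds_def)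
  have star: "xstar \<in> {0..1}" "norm1 xstar \<le> k" using opt by (auto simp: is_arg_max_def)
  have p: "0 < p" "p \<le> 1" using eps unfolding p_def by (simp_all only: zero_less_power power_le_one)
  define gap where "gap = p * f xstar - f xend - 3 * \<epsilon> * f xstar"
  define D where "D = f xend - f xstart"
  define G where "G w = (\<Sum>l\<in>UNIV. growth zstart zend l * max 0 (gvec f zend $ l - w))" for w
  have growth: "0 \<le> growth zstart zend l" for l
    using zs zs1[of l] by (auto simp: growth_def less_eq_vec_def)
  have G: "0 \<le> G w" for w using growth by (auto simp: G_def intro!: sum_nonneg mult_nonneg_nonneg)
  have norm_mono: "norm1 zstart \<le> norm1 zend" using zs0 zs by (rule norm1_mono)
  have D: "(1 - \<epsilon>) * w * (norm1 zend - norm1 zstart) + G w \<le> D" if "0 \<le> w" "w \<le> v" for w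
    using gain[OF that] by (simp add: gain_bound_def D_def G_def)
  have key: "\<epsilon> * (1 - \<epsilon>)\<^sup>2 * gap \<le> D" if gap_pos: "0 < gap"
  proof -
    have "0 \<le> f xend" using bounds zend by (intro f_nonneg) (auto intro: order_trans)
    moreover have star0: "0 \<le> f xstar" using star by (intro f_nonneg)
    ultimately have "0 < (p - 3 * \<epsilon>) * f xstar" using gap_pos by (simp add: gap_def algebra_simps)
    \<comment> \<open>A positive \<open>gap\<close> forces this; it makes
      \<open>p - 2 * \<epsilon>\<close> positive, so that both bounds on \<open>M\<close> can be
      multiplied by it.\<close>
    then have p3: "3 * \<epsilon> < p" using star0 by (simp add: zero_less_mult_iff)
    then have "(p - 2 * \<epsilon>) * f xstar \<le> (p - 2 * \<epsilon>) * M"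
      using M eps by (intro mult_left_mono) auto
    moreover have "0 \<le> \<epsilon> * f xstar" using eps star0 by simp
    moreover have kvs_eq: "k * vs = (p - 2 * \<epsilon>) * M - f xstart" using k_pos by (simp add: vs_def)
    ultimately have kvs: "gap \<le> k * vs"
      using mono by (simp add: gap_def algebra_simps)
    then have "0 < k * vs" using gap_pos by simp
    then have vs: "0 < vs" using k_pos by (simp add: zero_less_mult_iff)
    \<comment> \<open>At the norm limit, the phase has added at least \<open>\<epsilon> * k\<close>
      to the norm, which was at most \<open>\<epsilon> * real i * k\<close> at its start.\<close>
    have full: "(1 - \<epsilon>) * w * (\<epsilon> * k) + G w \<le> D"
      if "0 \<le> w" "w \<le> v" "\<epsilon> * real (Suc i) * k \<le> norm1 zend" for w
    proof -
      have "\<epsilon> * k \<le> norm1 zend - norm1 zstart" using that(3) zs_norm by (simp add: algebra_simps)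
      then have "(1 - \<epsilon>) * w * (\<epsilon> * k) \<le> (1 - \<epsilon>) * w * (norm1 zend - norm1 zstart)"
        using that eps by (intro mult_left_mono) auto
      then show ?thesis using D[OF that(1,2)] by simp
    qed
    show ?thesis
    proof (cases "v = vs")
      case True
      \<comment> \<open>An unlowered threshold cannot be the reason for leaving the loop, so the
        norm limit is.\<close>
      have "\<epsilon> * vs < vs" using vs eps by simp
      then have "\<epsilon> * real (Suc i) * k \<le> norm1 zend" using exit unfolding True by linarith
      then have "(1 - \<epsilon>) * vs * (\<epsilon> * k) + G vs \<le> D"
        using vs True by (intro full) auto
      moreover have "(1 - \<epsilon>)\<^sup>2 \<le> 1 - \<epsilon>"
        using eps by (simp add: power2_eq_square mult_left_le_one_le)
      then have "\<epsilon> * (1 - \<epsilon>)\<^sup>2 * gap \<le> \<epsilon> * (1 - \<epsilon>) * (k * vs)"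
        using eps gap_pos kvs by (intro mult_mono mult_left_mono mult_nonneg_nonneg) auto
      moreover have "\<epsilon> * (1 - \<epsilon>) * (k * vs) = (1 - \<epsilon>) * vs * (\<epsilon> * k)" by (simp only: mult_ac)
      ultimately show ?thesis using G[of vs] by linarith
    next
      case False
      then have vpos: "0 < v"
        and dich: "\<And>l. gvec f zend $ l \<le> v / (1 - \<epsilon>) \<or> \<epsilon> / (1 + \<epsilon>) \<le> growth zstart zend l"
        using v by auto
      define r where "r = (1 - \<epsilon>\<^sup>2) * p"
      have e2: "\<epsilon>\<^sup>2 < 1" using eps by (simp add: power_less_one_iff)
      then have "r \<le> 1 - \<epsilon>\<^sup>2" using p unfolding r_def by (simp add: mult_left_le)
      moreover have "0 < \<epsilon>\<^sup>2" using eps by simp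
      ultimately have "r < 1" by linarith
      moreover have "0 < r" using e2 p by (simp add: r_def)
      ultimately have r: "0 < r" "r < 1" by simp_all
      have "zend $ l \<le> 1 - r" for l using bounds(4)[of l] by (simp add: r_def)
      then have lower: "r * f xstar \<le> f (sup xstar zend)"
        using sup_lower_bound[OF f_dr f_nonneg star(1) zend(1), of "1 - r"] r by simp
      \<comment> \<open>\<open>c\<close> is the reciprocal of the guaranteed \<open>growth\<close>;
        \<open>u\<close> is the bound on \<open>gvec\<close> where that growth is not
        reached.\<close>
      define c where "c = (1 + \<epsilon>) / \<epsilon>"
      define u where "u = v / (1 - \<epsilon>)"
      have c: "0 \<le> c" "\<epsilon> * c = 1 + \<epsilon>" using eps by (auto simp: c_def)
      have u: "(1 - \<epsilon>) * u = v" "v \<le> u" using eps vpos by (auto simp: u_def le_divide_eq)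
      \<comment> \<open>With enough growth, \<open>c * growth\<close> is at least 1 and covers the
        excess over \<open>v\<close>, while \<open>u \<ge> v\<close> covers the rest. Otherwise
        \<open>u\<close> alone bounds the entry.\<close>
      have summand: "xstar $ l * max 0 (gvec f zend $ l) \<le>
          c * (growth zstart zend l * max 0 (gvec f zend $ l - v)) + u * xstar $ l" for l
      proof -
        let ?g = "gvec f zend $ l"
        define m where "m = max 0 (?g - v)"
        define a where "a = growth zstart zend l"
        have m: "0 \<le> m" "max 0 ?g \<le> m + u" using u(2) vpos by (auto simp: m_def)
        have x: "0 \<le> xstar $ l" "xstar $ l \<le> 1" using star by (auto simp: less_eq_vec_def)
        have cam: "0 \<le> c * (a * m)" using growth[of l] m c by (simp add: a_def)
        show ?thesis
        proof (cases "\<epsilon> / (1 + \<epsilon>) \<le> a")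
          case True
          then have "\<epsilon> \<le> \<epsilon> * (c * a)"
            using eps c(2) by (simp add: divide_le_eq mult.commute flip: mult.assoc)
          then have "1 \<le> c * a" using eps by simp
          then have "xstar $ l * m \<le> (c * a) * m" using x m by (intro mult_right_mono) auto
          moreover have "xstar $ l * max 0 ?g \<le> xstar $ l * (m + u)"
            using x m by (intro mult_left_mono) auto
          ultimately show ?thesis by (simp add: algebra_simps flip: a_def m_def)
        next
          case False
          then have "?g \<le> u" using dich[of l] by (simp add: a_def u_def)
          then have "max 0 ?g \<le> u" using u(2) vpos by simp
          then have "xstar $ l * max 0 ?g \<le> xstar $ l * u" using x by (intro mult_left_mono) auto
          then show ?thesis using cam by (simp add: mult.commute flip: a_def m_def)
        qed
      qed
      have "f (sup xstar zend) - f zend \<le> (\<Sum>l\<in>UNIV. xstar $ l * max 0 (gvec f zend $ l))"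
        using star zend by (intro sup_upper_bound[OF f_dr]) auto
      also have "\<dots> \<le> (\<Sum>l\<in>UNIV. c * (growth zstart zend l * max 0 (gvec f zend $ l - v)) + u * xstar $ l)"
        by (intro sum_mono summand)
      also have "\<dots> = c * G v + u * norm1 xstar"
        using star by (simp add: sum.distrib sum_distrib_left norm1_nonneg_eq G_def)
      also have "u * norm1 xstar \<le> u * k"
        using star vpos u(2) by (intro mult_left_mono) auto
      finally have F: "r * f xstar - f xend \<le> c * G v + u * k"
        using bounds(3) lower by simp
      \<comment> \<open>Replacing \<open>r\<close> by \<open>p - \<epsilon>\<close> uses one of the
        three \<open>\<epsilon> * f xstar\<close> in \<open>gap\<close>; the other two are kept to
        absorb \<open>u * k\<close> when \<open>v\<close> is small.\<close>
      have "\<epsilon>\<^sup>2 * p \<le> \<epsilon>" using eps p mult_mono[of "\<epsilon>\<^sup>2" \<epsilon> p 1] by (simp add: power2_eq_square)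
      then have "(p - \<epsilon>) * f xstar \<le> r * f xstar"
        using star0 by (intro mult_right_mono) (auto simp: r_def algebra_simps)
      then have F': "gap + 2 * \<epsilon> * f xstar \<le> c * G v + u * k"
        using F by (simp add: gap_def algebra_simps)
      have "(1 - \<epsilon>) * (1 - \<epsilon>\<^sup>2) \<le> 1" using eps e2 by (intro mult_le_one) auto
      then have "(1 - \<epsilon>)\<^sup>2 * (1 + \<epsilon>) \<le> 1" by (simp add: power2_eq_square algebra_simps)
      then have "(1 - \<epsilon>)\<^sup>2 * (\<epsilon> * c) * G v \<le> 1 * G v" unfolding c(2) using G by (rule mult_right_mono)
      then have cG: "\<epsilon> * (1 - \<epsilon>)\<^sup>2 * (c * G v) \<le> G v" by (simp only: mult_ac mult_1)
      have nonneg: "0 \<le> \<epsilon> * (1 - \<epsilon>)\<^sup>2" using eps by simp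
      from exit show ?thesis
      proof
        assume low: "v \<le> \<epsilon> * vs"
        have "k * v \<le> \<epsilon> * (k * vs)" using low k_pos by (simp add: mult_left_mono mult.left_commute)
        also have "k * vs \<le> (p - 2 * \<epsilon>) * M"
          using f_nonneg[OF xstart] by (simp add: kvs_eq)
        also have "(p - 2 * \<epsilon>) * M \<le> 1 * ((1 + \<epsilon>) * f xstar)"
          using p p3 eps M star0 by (intro mult_mono) auto
        \<comment> \<open>From \<open>5 * \<epsilon> \<le> 1\<close> follows
          \<open>1 + \<epsilon> \<le> 2 * (1 - \<epsilon>)\<close>; the factor
          \<open>1 - \<epsilon>\<close> then cancels the one in \<open>u\<close>.\<close>
        also have "\<dots> \<le> (2 * (1 - \<epsilon>)) * f xstar"
          using eps eps_small star0 by (simp add: mult_right_mono)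
        finally have "k * v \<le> \<epsilon> * ((2 * (1 - \<epsilon>)) * f xstar)" using eps by simp
        then have "(1 - \<epsilon>) * (u * k) \<le> (1 - \<epsilon>) * (2 * \<epsilon> * f xstar)"
          unfolding u(1)[symmetric] by (simp only: mult_ac)
        then have "u * k \<le> 2 * \<epsilon> * f xstar"
          using eps by (simp only: mult_le_cancel_left_pos diff_gt_0_iff_gt)
        then have "gap \<le> c * G v" using F' by simp
        then have "\<epsilon> * (1 - \<epsilon>)\<^sup>2 * gap \<le> \<epsilon> * (1 - \<epsilon>)\<^sup>2 * (c * G v)"
          using nonneg by (rule mult_left_mono)
        also note cG
        also have "G v \<le> (1 - \<epsilon>) * v * (norm1 zend - norm1 zstart) + G v"
          using eps vpos norm_mono by simp
        also have "\<dots> \<le> D" using D[of v] vpos by simp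
        finally show ?thesis .
      next
        assume high: "\<epsilon> * real (Suc i) * k \<le> norm1 zend"
        have "gap \<le> c * G v + u * k"
          using F' \<open>0 \<le> \<epsilon> * f xstar\<close> by simp
        then have "\<epsilon> * (1 - \<epsilon>)\<^sup>2 * gap \<le> \<epsilon> * (1 - \<epsilon>)\<^sup>2 * (c * G v + u * k)"
          using nonneg by (rule mult_left_mono)
        \<comment> \<open>One factor \<open>1 - \<epsilon>\<close> turns \<open>u\<close> into
          \<open>v\<close>; the other is the coefficient of the norm term in
          \<open>gain_bound\<close>.\<close>
        also have "\<dots> = \<epsilon> * (1 - \<epsilon>)\<^sup>2 * (c * G v) + (1 - \<epsilon>) * ((1 - \<epsilon>) * u) * (\<epsilon> * k)"
          by (simp only: distrib_left power2_eq_square mult_ac)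
        also have "\<dots> \<le> G v + (1 - \<epsilon>) * v * (\<epsilon> * k)" using cG unfolding u(1) by simp
        also have "\<dots> \<le> D" using full[of v] vpos high by simp
        finally show ?thesis .
      qed
    qed
  qed
  have "(1 - 5 * \<epsilon>) * \<epsilon> * gap \<le> D"
  proof (cases "0 < gap")
    case True
    have "1 - 5 * \<epsilon> \<le> (1 - \<epsilon>)\<^sup>2" using eps by (simp add: power2_eq_square algebra_simps)
    then have "(1 - 5 * \<epsilon>) * (\<epsilon> * gap) \<le> (1 - \<epsilon>)\<^sup>2 * (\<epsilon> * gap)"
      using True eps(1) by (intro mult_right_mono) auto
    also have "\<dots> = \<epsilon> * (1 - \<epsilon>)\<^sup>2 * gap" by (simp only: mult_ac)
    also have "\<dots> \<le> D" by (rule key[OF True])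
    finally show ?thesis by (simp only: mult.assoc)
  next
    \<comment> \<open>The left-hand side is then nonpositive, since
      \<open>5 * \<epsilon> \<le> 1\<close>, and \<open>f\<close> has not decreased during the
      phase.\<close>
    case False
    then have "(1 - 5 * \<epsilon>) * \<epsilon> * gap \<le> 0"
      using eps(1) eps_small by (intro mult_nonneg_nonpos) auto
    also have "0 \<le> D" using mono by (simp add: D_def)
    finally show ?thesis .
  qed
  then show ?thesis unfolding gap_def D_def p_def i .
qed

end
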